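(* Let $n=1$, $s=1/2$, $\sigma\in(0,1)$, and let $(u,E)$ be a minimizing pair in $(-1,1)$, with $u\in C([-1,1])\cap H^{1/2}(\mathbb R)$. Then either $(-\Delta)^{1/2}u=0$ in $(-1,1)$ or the set $\{u=0\}\cap(-1,1)$ contains infinitely many points.
   Context: $A^c=\mathbb R^n\setminus A$. For disjoint measurable $A,B\subseteq\mathbb R^n$ let $\mathcal L(A,B)=\iint_{A\times B}\frac{dx\,dy}{|x-y|^{n+\sigma}}$. For a bounded Lipschitz domain $\Omega\subset\mathbb R^n$ and measurable $E\subseteq\mathbb R^n$, $$\mathrm{Per}_\sigma(E,\Omega)=\mathcal L(E\cap\Omega,E^c\cap\Omega)+\mathcal L(E\cap\Omega,E^c\cap\Omega^c)+\mathcal L(E\cap\Omega^c,E^c\cap\Omega),$$ $$\mathcal F(u,E)=\iint_{\mathbb R^{2n}\setminus(\Omega^c)^2}\frac{|u(x)-u(y)|^2}{|x-y|^{n+2s}}\,dx\,dy+\mathrm{Per}_\sigma(E,\Omega).$$ Minimizing pair in $\Omega$: fix external data, i.e. a set $E_0\subseteq\mathbb R^n$ with locally finite $\sigma$-perimeter and $\varphi\in H^s_{\rm loc}(\mathbb R^n)$ with $\varphi\ge0$ a.e. in $E_0$ and $\varphi\le0$ a.e. in $E_0^c$. A pair $(v,F)$ is admissible if $v-\varphi\in H^s(\mathbb R^n)$, $v=\varphi$ a.e. in $\Omega^c$, $F\subseteq\mathbb R^n$ is measurable with $F\setminus\Omega=E_0\setminus\Omega$, and $v\ge0$ a.e. in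 $F\cap\Omega$, $v\le0$ a.e. in $F^c\cap\Omega$. A pair $(u,E)$ is a minimizing pair in $\Omega$ if, for some such data, it is admissible and $\mathcal F(u,E)\le\mathcal F(v,F)$ for every admissible $(v,F)$. The equation $(-\Delta)^{1/2}u=0$ is equivalently understood in the weak or classical sense, where $(-\Delta)^{s}u(x)$ is, up to a positive constant, $\mathrm{P.V.}\int_{\mathbb R^n}\frac{u(x)-u(y)}{|x-y|^{n+2s}}dy$. *)

theory Defs
  imports "HOL-Analysis.Analysis"
begin

text \<open>
  Everything is stated for an arbitrary set \<open>\<Omega>\<close>; the requirement that \<open>\<Omega>\<close> is a bounded Lipschitz
  domain belongs to the statements that use these notions. Energies are extended nonnegative
  integrals, so infinite values are allowed. On the diagonal (a null set) the kernels take the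
  value 0, by the convention for division by zero.
\<close>

definition interaction :: "real \<Rightarrow> 'a::euclidean_space set \<Rightarrow> 'a set \<Rightarrow> ennreal" where
  "interaction \<sigma> A B =
     (\<integral>\<^sup>+ z \<in> A \<times> B. ennreal (1 / dist (fst z) (snd z) powr (real DIM('a) + \<sigma>)) \<partial>lebesgue)"

definition frac_perimeter :: "real \<Rightarrow> 'a::euclidean_space set \<Rightarrow> 'a set \<Rightarrow> ennreal" where
  "frac_perimeter \<sigma> E \<Omega> =
     interaction \<sigma> (E \<inter> \<Omega>) (- E \<inter> \<Omega>)
     + interaction \<sigma> (E \<inter> \<Omega>) (- E \<inter> - \<Omega>)
     + interaction \<sigma> (E \<inter> - \<Omega>) (- E \<inter> \<Omega>)"

definition gagliardo_energy ::
    "real \<Rightarrow> ('a::euclidean_space \<times> 'a) set \<Rightarrow> ('a \<Rightarrow> real) \<Rightarrow> ennreal" where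
  "gagliardo_energy s D u =
     (\<integral>\<^sup>+ z \<in> D. ennreal (\<bar>u (fst z) - u (snd z)\<bar>\<^sup>2
                          / dist (fst z) (snd z) powr (real DIM('a) + 2 * s)) \<partial>lebesgue)"

definition free_energy ::
    "real \<Rightarrow> real \<Rightarrow> 'a::euclidean_space set \<Rightarrow> ('a \<Rightarrow> real) \<Rightarrow> 'a set \<Rightarrow> ennreal" where
  "free_energy s \<sigma> \<Omega> u E =
     gagliardo_energy s (UNIV - (- \<Omega>) \<times> (- \<Omega>)) u + frac_perimeter \<sigma> E \<Omega>"

definition frac_sobolev :: "real \<Rightarrow> 'a::euclidean_space set \<Rightarrow> ('a \<Rightarrow> real) set" where
  "frac_sobolev s U =
     {v. v \<in> borel_measurable (lebesgue_on U)
       \<and> (\<integral>\<^sup>+ x \<in> U. ennreal (\<bar>v x\<bar>\<^sup>2) \<partial>lebesgue) < \<infinity>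
       \<and> gagliardo_energy s (U \<times> U) v < \<infinity>}"

definition frac_sobolev_loc :: "real \<Rightarrow> ('a::euclidean_space \<Rightarrow> real) set" where
  "frac_sobolev_loc s = {v. \<forall>R>0. v \<in> frac_sobolev s (ball 0 R)}"

definition locally_finite_frac_perimeter :: "real \<Rightarrow> 'a::euclidean_space set \<Rightarrow> bool" where
  "locally_finite_frac_perimeter \<sigma> E \<longleftrightarrow>
     E \<in> sets lebesgue \<and> (\<forall>R>0. frac_perimeter \<sigma> E (ball 0 R) < \<infinity>)"

definition external_data ::
    "real \<Rightarrow> real \<Rightarrow> ('a::euclidean_space \<Rightarrow> real) \<Rightarrow> 'a set \<Rightarrow> bool" where
  "external_data s \<sigma> \<phi> E0 \<longleftrightarrow>
     locally_finite_frac_perimeter \<sigma> E0 \<and> \<phi> \<in> frac_sobolev_loc s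
     \<and> (AE x\<in>E0 in lebesgue. \<phi> x \<ge> 0) \<and> (AE x\<in>- E0 in lebesgue. \<phi> x \<le> 0)"

definition admissible_pair ::
    "real \<Rightarrow> 'a::euclidean_space set \<Rightarrow> ('a \<Rightarrow> real) \<Rightarrow> 'a set \<Rightarrow> ('a \<Rightarrow> real) \<Rightarrow> 'a set \<Rightarrow> bool" where
  "admissible_pair s \<Omega> \<phi> E0 v F \<longleftrightarrow>
     (\<lambda>x. v x - \<phi> x) \<in> frac_sobolev s UNIV
     \<and> (AE x\<in>- \<Omega> in lebesgue. v x = \<phi> x)
     \<and> F \<in> sets lebesgue \<and> F - \<Omega> = E0 - \<Omega>
     \<and> (AE x\<in>F \<inter> \<Omega> in lebesgue. v x \<ge> 0) \<and> (AE x\<in>- F \<inter> \<Omega> in lebesgue. v x \<le> 0)"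

definition minimizing_pair ::
    "real \<Rightarrow> real \<Rightarrow> 'a::euclidean_space set \<Rightarrow> ('a \<Rightarrow> real) \<Rightarrow> 'a set \<Rightarrow> bool" where
  "minimizing_pair s \<sigma> \<Omega> u E \<longleftrightarrow>
     (\<exists>\<phi> E0. external_data s \<sigma> \<phi> E0
        \<and> admissible_pair s \<Omega> \<phi> E0 u E
        \<and> (\<forall>v F. admissible_pair s \<Omega> \<phi> E0 v F \<longrightarrow>
               free_energy s \<sigma> \<Omega> u E \<le> free_energy s \<sigma> \<Omega> v F))"

primrec C_k :: "nat \<Rightarrow> ('a::euclidean_space \<Rightarrow> real) \<Rightarrow> bool" where
  "C_k 0 f \<longleftrightarrow> continuous_on UNIV f"
| "C_k (Suc k) f \<longleftrightarrow>
     f differentiable_on UNIV \<and> (\<forall>b\<in>Basis. C_k k (\<lambda>x. frechet_derivative f (at x) b))"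

definition test_functions :: "'a::euclidean_space set \<Rightarrow> ('a \<Rightarrow> real) set" where
  "test_functions \<Omega> =
     {\<eta>. (\<forall>k. C_k k \<eta>) \<and> compact (closure {x. \<eta> x \<noteq> 0}) \<and> closure {x. \<eta> x \<noteq> 0} \<subseteq> \<Omega>}"

text \<open>
  Weak form of the equation \<open>(-\<Delta>)\<^sup>s u = 0\<close> in \<open>\<Omega>\<close>, obtained by pairing the principal value
  integral with a test function and symmetrizing in the two variables. Using
  \<^const>\<open>has_bochner_integral\<close> makes integrability part of the claim, whereas the integral of a
  nonintegrable function would be 0 by convention.
\<close>

definition frac_laplacian_zero ::
    "real \<Rightarrow> 'a::euclidean_space set \<Rightarrow> ('a \<Rightarrow> real) \<Rightarrow> bool" where
  "frac_laplacian_zero s \<Omega> u \<longleftrightarrow>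
     (\<forall>\<eta>\<in>test_functions \<Omega>.
        has_bochner_integral lebesgue
          (\<lambda>z. (u (fst z) - u (snd z)) * (\<eta> (fst z) - \<eta> (snd z))
               / dist (fst z) (snd z) powr (real DIM('a) + 2 * s)) 0)"

end

theory Submission
  imports Defs "HOL-Probability.Sinc_Integral"
begin

text \<open>
  Points have zero \<open>H\<^sup>1\<^sup>/\<^sup>2\<close>-capacity on the line. Where \<open>u\<close> does not vanish, small perturbations of \<open>u\<close>
  keep the sign constraint and leave \<open>E\<close> alone, so minimality gives the weak equation for test
  functions supported away from the zero set. If that set is finite, its points are removed one at a
  time with cutoffs \<open>\<kappa>((x - a)/r)\<close>: their Gagliardo energy is bounded uniformly in \<open>r\<close> by scale
  invariance, while the part of the energy of \<open>u\<close> that they meet tends to 0 with \<open>r\<close>.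
\<close>

text \<open>On the line with s = 1/2 the kernel exponent n + 2s equals 2, so the energy is the
  squared L2 norm over the plane of a difference quotient, and the weak equation says that
  \<open>energy_form u \<eta>\<close> vanishes. Zero capacity is often exploited through logarithmic
  cutoffs whose energy tends to 0. Plain rescaling keeps the energy merely bounded at this critical
  exponent, which is enough here because the pairing is with the fixed function \<open>u\<close>:
  the bounded factor gets a small weight, and the energy of \<open>u\<close> on thin strips is then
  made smaller still. The cutoffs are Lipschitz and not smooth. Therefore the first variation and
  the removability lemmas are stated for bounded functions of finite energy, a class closed under
  products, so that points can be removed repeatedly. Continuity of \<open>u\<close> enters once: it
  bounds |u| away from 0 on compact sets that avoid the zeros, which makes small perturbations of
  either sign admissible and turns an inequality into an equation.\<close>

definition diff_quot :: "(real \<Rightarrow> real) \<Rightarrow> real \<times> real \<Rightarrow> real" where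
  "diff_quot f z = (f (fst z) - f (snd z)) / dist (fst z) (snd z)"

text \<open>Only the seminorm part of H^(1/2). Square integrability of \<open>f\<close> itself is
  kept apart, since the bilinear form does not see it.\<close>

definition finite_energy :: "(real \<Rightarrow> real) \<Rightarrow> bool" where
  "finite_energy f \<longleftrightarrow> f \<in> borel_measurable lebesgue \<and> integrable lebesgue (\<lambda>z. (diff_quot f z)\<^sup>2)"

text \<open>The polar form of the Gagliardo energy over the whole plane, as in the weak equation,
  although the minimized energy omits the pairs with both points outside the interval.\<close>

definition energy_form :: "(real \<Rightarrow> real) \<Rightarrow> (real \<Rightarrow> real) \<Rightarrow> real" where
  "energy_form f g = integral\<^sup>L lebesgue (\<lambda>z. diff_quot f z * diff_quot g z)"

lemma diff_quot_add: "diff_quot (\<lambda>x. f x + g x) z = diff_quot f z + diff_quot g z"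
  and diff_quot_diff: "diff_quot (\<lambda>x. f x - g x) z = diff_quot f z - diff_quot g z"
  and diff_quot_scale: "diff_quot (\<lambda>x. c * f x) z = c * diff_quot f z"
  by (simp_all add: diff_quot_def add_divide_distrib diff_divide_distrib algebra_simps)

lemma dist_powr_2: "dist x y powr 2 = (dist x y)\<^sup>2" for x y :: real
  by (cases "x = y") (simp_all add: powr_numeral)

lemma gagliardo_energy_half:
  "gagliardo_energy (1/2) D f = (\<integral>\<^sup>+ z. ennreal (indicator D z * (diff_quot f z)\<^sup>2) \<partial>lebesgue)"
  for f :: "real \<Rightarrow> real"
  unfolding gagliardo_energy_def
  by (intro nn_integral_cong)
     (auto simp: diff_quot_def dist_powr_2 power_divide indicator_def)

section \<open>Lebesgue measurability on the plane\<close>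

lemma null_sets_lborel_fst_snd:
  fixes N :: "real set"
  assumes "N \<in> null_sets lborel"
  shows "fst -` N \<in> null_sets (lebesgue :: (real \<times> real) measure)"
    and "snd -` N \<in> null_sets (lebesgue :: (real \<times> real) measure)"
proof -
  have N: "N \<in> sets borel" "emeasure lborel N = 0"
    using assms by auto
  have eq: "fst -` N = N \<times> (UNIV :: real set)" "snd -` N = (UNIV :: real set) \<times> N"
    by auto
  have "emeasure (lborel \<Otimes>\<^sub>M lborel) (N \<times> (UNIV :: real set)) = 0"
       "emeasure (lborel \<Otimes>\<^sub>M lborel) ((UNIV :: real set) \<times> N) = 0"
    using N by (simp_all add: lborel.emeasure_pair_measure_Times)
  moreover have "N \<times> (UNIV :: real set) \<in> sets (lborel \<Otimes>\<^sub>M lborel)"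
       "(UNIV :: real set) \<times> N \<in> sets (lborel \<Otimes>\<^sub>M lborel)"
    using N by (auto intro!: pair_measureI)
  ultimately show "fst -` N \<in> null_sets (lebesgue :: (real \<times> real) measure)"
    and "snd -` N \<in> null_sets (lebesgue :: (real \<times> real) measure)"
    unfolding eq lborel_prod by (auto intro!: null_sets_completionI)
qed

text \<open>Functions such as \<open>u\<close> are only Lebesgue measurable, so the projections must
  be measurable between the completed measures. Beyond continuity this requires that preimages of
  null sets be null: they are strips of measure 0 times infinity, which is 0.\<close>

lemma measurable_fst_snd_lebesgue:
  shows "fst \<in> measurable (lebesgue :: (real \<times> real) measure) (lebesgue :: real measure)"
    and "snd \<in> measurable (lebesgue :: (real \<times> real) measure) (lebesgue :: real measure)"
proof -
  have m: "fst \<in> measurable (lebesgue :: (real \<times> real) measure) (lborel :: real measure)"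
    "snd \<in> measurable (lebesgue :: (real \<times> real) measure) (lborel :: real measure)"
    by (auto intro!: measurable_completion borel_measurable_continuous_onI continuous_intros)
  show "fst \<in> measurable (lebesgue :: (real \<times> real) measure) (lebesgue :: real measure)"
    by (rule completion.measurable_completion2[OF m(1)])
       (use m null_sets_lborel_fst_snd in \<open>auto simp: null_sets_def emeasure_distr simp del: emeasure_completion\<close>)
  show "snd \<in> measurable (lebesgue :: (real \<times> real) measure) (lebesgue :: real measure)"
    by (rule completion.measurable_completion2[OF m(2)])
       (use m null_sets_lborel_fst_snd in \<open>auto simp: null_sets_def emeasure_distr simp del: emeasure_completion\<close>)
qed

lemma AE_lebesgue_fst_snd_neq:
  fixes a :: real
  shows "AE z in (lebesgue :: (real \<times> real) measure). fst z \<noteq> a \<and> snd z \<noteq> a"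
proof -
  have "{a} \<in> null_sets lborel" by auto
  from null_sets_lborel_fst_snd[OF this, THEN AE_not_in] show ?thesis
    by eventually_elim auto
qed

lemma borel_measurable_diff_quot:
  assumes "f \<in> borel_measurable (lebesgue :: real measure)"
  shows "diff_quot f \<in> borel_measurable lebesgue"
proof -
  have [measurable]: "(\<lambda>z. f (fst z)) \<in> borel_measurable (lebesgue :: (real \<times> real) measure)"
    "(\<lambda>z. f (snd z)) \<in> borel_measurable (lebesgue :: (real \<times> real) measure)"
    using assms measurable_fst_snd_lebesgue by (auto intro: measurable_compose)
  have [measurable]: "(\<lambda>z. dist (fst z) (snd z)) \<in> borel_measurable (lebesgue :: (real \<times> real) measure)"
    by (auto intro!: measurable_completion borel_measurable_continuous_onI continuous_intros)
  show ?thesis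
    unfolding diff_quot_def[abs_def] by measurable
qed

section \<open>Functions of finite energy and their bilinear form\<close>

lemma finite_energyI:
  assumes f: "f \<in> borel_measurable lebesgue"
    and g: "integrable lebesgue g" and le: "\<And>z. (diff_quot f z)\<^sup>2 \<le> g z"
  shows "finite_energy f"
proof -
  have "integrable lebesgue (\<lambda>z. (diff_quot f z)\<^sup>2)"
    using borel_measurable_diff_quot[OF f] le
    by (intro Bochner_Integration.integrable_bound[OF g]) (auto intro!: AE_I2 order_trans[OF le])
  with f show ?thesis by (simp add: finite_energy_def)
qed

lemma square_add_le: "(a + b)\<^sup>2 \<le> 2 * a\<^sup>2 + 2 * b\<^sup>2" for a b :: real
  using zero_le_power2[of "a - b"] by (simp add: power2_eq_square algebra_simps)

lemma finite_energy_add: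
  assumes "finite_energy f" "finite_energy g"
  shows "finite_energy (\<lambda>x. f x + g x)"
proof (rule finite_energyI)
  show "integrable lebesgue (\<lambda>z. 2 * (diff_quot f z)\<^sup>2 + 2 * (diff_quot g z)\<^sup>2)"
    using assms by (auto simp: finite_energy_def)
qed (use assms in \<open>auto simp: finite_energy_def diff_quot_add square_add_le\<close>)

lemma finite_energy_scale:
  assumes "finite_energy f"
  shows "finite_energy (\<lambda>x. c * f x)"
  using assms by (auto simp: finite_energy_def diff_quot_scale power_mult_distrib)

lemma finite_energy_diff:
  assumes "finite_energy f" "finite_energy g"
  shows "finite_energy (\<lambda>x. f x - g x)"
  using finite_energy_add[OF assms(1) finite_energy_scale[OF assms(2), of "-1"]] by simp

text \<open>The product rule for difference quotients, with \<open>f\<close> evaluated at one point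
  and \<open>g\<close> at the other, followed by \<open>square_add_le\<close>.\<close>

lemma diff_quot_mult_le:
  assumes "\<And>x. \<bar>f x\<bar> \<le> M" "\<And>x. \<bar>g x\<bar> \<le> N"
  shows "(diff_quot (\<lambda>x. f x * g x) z)\<^sup>2 \<le> 2 * (M\<^sup>2 * (diff_quot g z)\<^sup>2) + 2 * (N\<^sup>2 * (diff_quot f z)\<^sup>2)"
proof -
  have "diff_quot (\<lambda>x. f x * g x) z = f (fst z) * diff_quot g z + g (snd z) * diff_quot f z"
    by (cases "fst z = snd z") (auto simp: diff_quot_def field_simps)
  moreover have "(f (fst z) * diff_quot g z)\<^sup>2 \<le> M\<^sup>2 * (diff_quot g z)\<^sup>2"
    "(g (snd z) * diff_quot f z)\<^sup>2 \<le> N\<^sup>2 * (diff_quot f z)\<^sup>2"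
    using assms by (auto simp: power_mult_distrib intro!: mult_right_mono abs_le_square_iff[THEN iffD1] order_trans[OF _ abs_ge_self])
  ultimately show ?thesis
    by (auto intro!: order_trans[OF square_add_le] add_mono)
qed

lemma finite_energy_mult:
  assumes "finite_energy f" "finite_energy g" "\<And>x. \<bar>f x\<bar> \<le> M" "\<And>x. \<bar>g x\<bar> \<le> N"
  shows "finite_energy (\<lambda>x. f x * g x)"
proof (rule finite_energyI)
  show "integrable lebesgue (\<lambda>z. 2 * (M\<^sup>2 * (diff_quot g z)\<^sup>2) + 2 * (N\<^sup>2 * (diff_quot f z)\<^sup>2))"
    using assms by (auto simp: finite_energy_def)
qed (use assms in \<open>auto simp: finite_energy_def intro!: diff_quot_mult_le\<close>)

lemma integrable_diff_quot_mult:
  assumes "finite_energy f" "finite_energy g"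
  shows "integrable lebesgue (\<lambda>z. diff_quot f z * diff_quot g z)"
proof (rule Bochner_Integration.integrable_bound)
  show "integrable lebesgue (\<lambda>z. (diff_quot f z)\<^sup>2 + (diff_quot g z)\<^sup>2)"
    using assms by (auto simp: finite_energy_def)
  show "(\<lambda>z. diff_quot f z * diff_quot g z) \<in> borel_measurable lebesgue"
    using assms borel_measurable_diff_quot by (auto simp: finite_energy_def)
  have "\<bar>a * b\<bar> \<le> a\<^sup>2 + b\<^sup>2" for a b :: real
  proof -
    have "2 * (\<bar>a\<bar> * \<bar>b\<bar>) \<le> a\<^sup>2 + b\<^sup>2"
      using zero_le_power2[of "\<bar>a\<bar> - \<bar>b\<bar>"] by (simp add: power2_diff)
    moreover have "0 \<le> \<bar>a\<bar> * \<bar>b\<bar>" by simp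
    ultimately show ?thesis unfolding abs_mult by linarith
  qed
  then show "AE z in lebesgue. norm (diff_quot f z * diff_quot g z)
      \<le> norm ((diff_quot f z)\<^sup>2 + (diff_quot g z)\<^sup>2)"
    by (intro AE_I2) auto
qed

lemma energy_form_add:
  assumes "finite_energy f" "finite_energy g" "finite_energy h"
  shows "energy_form f (\<lambda>x. g x + h x) = energy_form f g + energy_form f h"
  using assms integrable_diff_quot_mult
  by (simp add: energy_form_def diff_quot_add distrib_left)

section \<open>The space H^(1/2) on the line\<close>

lemma frac_sobolev_half_iff:
  "f \<in> frac_sobolev (1/2) UNIV \<longleftrightarrow> finite_energy f \<and> integrable lebesgue (\<lambda>x. (f x)\<^sup>2)"
  for f :: "real \<Rightarrow> real"
proof (cases "f \<in> borel_measurable lebesgue")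
  case True
  then show ?thesis
    using borel_measurable_diff_quot[OF True]
    by (auto simp: frac_sobolev_def finite_energy_def gagliardo_energy_half integrable_iff_bounded
        lebesgue_on_UNIV_eq)
qed (auto simp: frac_sobolev_def finite_energy_def lebesgue_on_UNIV_eq)

lemma frac_sobolev_half_add:
  fixes f g :: "real \<Rightarrow> real"
  assumes "f \<in> frac_sobolev (1/2) UNIV" "g \<in> frac_sobolev (1/2) UNIV"
  shows "(\<lambda>x. f x + g x) \<in> frac_sobolev (1/2) UNIV"
proof -
  have m: "f \<in> borel_measurable lebesgue" "g \<in> borel_measurable lebesgue"
    using assms by (auto simp: frac_sobolev_half_iff finite_energy_def)
  have "integrable lebesgue (\<lambda>x. (f x + g x)\<^sup>2)"
  proof (rule Bochner_Integration.integrable_bound)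
    show "integrable lebesgue (\<lambda>x. 2 * (f x)\<^sup>2 + 2 * (g x)\<^sup>2)"
      using assms by (auto simp: frac_sobolev_half_iff)
  qed (use m in \<open>auto intro!: AE_I2 square_add_le\<close>)
  then show ?thesis
    using assms finite_energy_add by (auto simp: frac_sobolev_half_iff)
qed

lemma frac_sobolev_half_scale:
  fixes f :: "real \<Rightarrow> real"
  assumes "f \<in> frac_sobolev (1/2) UNIV"
  shows "(\<lambda>x. c * f x) \<in> frac_sobolev (1/2) UNIV"
  using assms finite_energy_scale by (auto simp: frac_sobolev_half_iff power_mult_distrib)

section \<open>Energy of rescaled Lipschitz bumps\<close>

lemma nn_integral_inverse_1_plus_square_finite:
  "(\<integral>\<^sup>+ x. ennreal (1 / (1 + x\<^sup>2)) \<partial>lborel) < \<infinity>"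
proof -
  have "set_integrable lborel UNIV (\<lambda>x::real. inverse (1 + x^2))"
    using integrable_inverse_1_plus_square by simp
  then have "integrable lborel (\<lambda>x::real. 1 / (1 + x\<^sup>2))"
    by (simp add: set_integrable_def inverse_eq_divide)
  then show ?thesis
    by (simp add: integrable_iff_bounded)
qed

text \<open>The majorant is a product so that its plane integral factorizes. If neither point is in
  [-1,1] the quotient is 0. If \<open>x\<close> is there, the quotient is at most \<open>L\<close>
  for \<open>y\<close> near and decays like 1/|y| for \<open>y\<close> far, so its square times 1 +
  y^2 stays bounded. The constant is a generous 50 from these two cases, times 2 for 1 +
  x^2.\<close>

lemma diff_quot_lipschitz_le:
  fixes f :: "real \<Rightarrow> real"
  assumes L: "\<And>x y. \<bar>f x - f y\<bar> \<le> L * \<bar>x - y\<bar>" and supp: "\<And>x. 1 < \<bar>x\<bar> \<Longrightarrow> f x = 0"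
  shows "(diff_quot f (x, y))\<^sup>2 \<le> 100 * L\<^sup>2 * (1 / (1 + x\<^sup>2)) * (1 / (1 + y\<^sup>2))"
proof -
  have "0 \<le> L" using order_trans[OF abs_ge_zero L[of 1 0]] by simp
  have *: "(diff_quot f (x, y))\<^sup>2 \<le> 100 * L\<^sup>2 * (1 / (1 + x\<^sup>2)) * (1 / (1 + y\<^sup>2))"
    if x: "\<bar>x\<bar> \<le> 1" for x y
  proof -
    have x2: "1 + x\<^sup>2 \<le> 2" using x by (simp add: abs_square_le_1)
    have "(diff_quot f (x, y))\<^sup>2 * (1 + y\<^sup>2) \<le> 50 * L\<^sup>2"
    proof (cases "\<bar>y\<bar> \<le> 3")
      case True
      have "\<bar>diff_quot f (x, y)\<bar> \<le> L"
        using L[of x y] \<open>0 \<le> L\<close> by (cases "x = y") (auto simp: diff_quot_def dist_real_def field_simps)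
      then have "(diff_quot f (x, y))\<^sup>2 \<le> L\<^sup>2"
        using \<open>0 \<le> L\<close> by (intro power2_le_iff_abs_le[THEN iffD2]) auto
      moreover have "1 + y\<^sup>2 \<le> 50"
        using abs_le_square_iff[of y 3] True by simp
      ultimately have "(diff_quot f (x, y))\<^sup>2 * (1 + y\<^sup>2) \<le> L\<^sup>2 * 50"
        by (intro mult_mono) auto
      then show ?thesis by simp
    next
      case False
      \<comment> \<open>The comparison point 2 lies outside the support and within distance 3 of
        \<open>x\<close>.\<close>
      have "\<bar>f x\<bar> \<le> 3 * L"
      proof -
        have "\<bar>f x\<bar> \<le> L * \<bar>x - 2\<bar>" using L[of x 2] supp[of 2] by simp
        also have "\<dots> \<le> L * 3" using x \<open>0 \<le> L\<close> by (intro mult_left_mono) auto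
        finally show ?thesis by simp
      qed
      moreover have "f y = 0" using supp False by auto
      moreover have d: "\<bar>y\<bar> / 2 \<le> dist x y" "0 < \<bar>y\<bar>"
        using False x abs_triangle_ineq2[of y x] by (auto simp: dist_real_def abs_minus_commute)
      ultimately have "\<bar>diff_quot f (x, y)\<bar> \<le> 3 * L / (\<bar>y\<bar> / 2)"
        unfolding diff_quot_def fst_conv snd_conv abs_divide abs_of_nonneg[OF zero_le_dist]
        by (intro frac_le) auto
      then have "(diff_quot f (x, y))\<^sup>2 \<le> (3 * L / (\<bar>y\<bar> / 2))\<^sup>2"
        using \<open>0 \<le> L\<close> by (intro power2_le_iff_abs_le[THEN iffD2]) auto
      also have "\<dots> = 36 * L\<^sup>2 / y\<^sup>2"
        by (simp add: power_divide power_mult_distrib)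
      finally have "(diff_quot f (x, y))\<^sup>2 * (1 + y\<^sup>2) \<le> 36 * L\<^sup>2 / y\<^sup>2 * (1 + y\<^sup>2)"
        by (intro mult_right_mono) auto
      also have "\<dots> = 36 * L\<^sup>2 / y\<^sup>2 + 36 * L\<^sup>2"
        using d by (simp add: field_simps)
      also have "36 * L\<^sup>2 / y\<^sup>2 \<le> 36 * L\<^sup>2 / 9"
        using abs_le_square_iff[of 3 y] False by (intro divide_left_mono) auto
      also have "36 * L\<^sup>2 / 9 + 36 * L\<^sup>2 \<le> 50 * L\<^sup>2"
        using zero_le_power2[of L] by linarith
      finally show ?thesis by simp
    qed
    then have "(diff_quot f (x, y))\<^sup>2 * (1 + y\<^sup>2) * (1 + x\<^sup>2) \<le> 50 * L\<^sup>2 * 2"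
      using x2 by (intro mult_mono[of "(diff_quot f (x, y))\<^sup>2 * (1 + y\<^sup>2)"]) auto
    moreover have "0 < 1 + x\<^sup>2" "0 < 1 + y\<^sup>2"
      by (auto intro: add_pos_nonneg)
    ultimately have "(diff_quot f (x, y))\<^sup>2 \<le> 100 * L\<^sup>2 / ((1 + x\<^sup>2) * (1 + y\<^sup>2))"
      by (subst pos_le_divide_eq) (simp_all add: mult_ac)
    then show ?thesis by simp
  qed
  consider "\<bar>x\<bar> \<le> 1" | "\<bar>y\<bar> \<le> 1" | "1 < \<bar>x\<bar>" "1 < \<bar>y\<bar>" by linarith
  then show ?thesis
  proof cases
    case 2
    have "(diff_quot f (x, y))\<^sup>2 = (diff_quot f (y, x))\<^sup>2"
      by (simp add: diff_quot_def dist_commute power_divide power2_commute)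
    then show ?thesis using *[OF 2, of x] by (simp add: mult_ac)
  qed (use * supp in \<open>auto simp: diff_quot_def\<close>)
qed

text \<open>The right-hand side does not depend on \<open>r\<close>: this is the scale invariance of the energy.\<close>

lemma energy_rescaled_lipschitz_le:
  fixes f :: "real \<Rightarrow> real"
  assumes L: "\<And>x y. \<bar>f x - f y\<bar> \<le> L * \<bar>x - y\<bar>" and supp: "\<And>x. 1 < \<bar>x\<bar> \<Longrightarrow> f x = 0" and r: "0 < r"
  shows "(\<integral>\<^sup>+ z. ennreal ((diff_quot (\<lambda>x. f ((x - a) / r)) z)\<^sup>2) \<partial>lebesgue)
     \<le> ennreal (100 * L\<^sup>2) * (\<integral>\<^sup>+ x. ennreal (1 / (1 + x\<^sup>2)) \<partial>lborel)\<^sup>2"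
proof -
  \<comment> \<open>Rescaling the quotient produces a factor 1/r^2. Giving 1/r to each variable
    makes \<open>g\<close> a translated and dilated copy of 1 / (1 + x^2) with the same
    integral.\<close>
  define g where "g x = ennreal (1 / (1 + ((x - a) / r)\<^sup>2) / r)" for x
  define J where "J = (\<integral>\<^sup>+ x. ennreal (1 / (1 + x\<^sup>2)) \<partial>(lborel :: real measure))"
  have gm [measurable]: "g \<in> borel_measurable borel" unfolding g_def by measurable
  have "J = ennreal \<bar>1 / r\<bar> * (\<integral>\<^sup>+ x. ennreal (1 / (1 + (- a / r + 1 / r * x)\<^sup>2)) \<partial>lborel)"
    unfolding J_def using r by (intro nn_integral_real_affine) auto
  also have "\<dots> = (\<integral>\<^sup>+ x. ennreal \<bar>1 / r\<bar> * ennreal (1 / (1 + (- a / r + 1 / r * x)\<^sup>2)) \<partial>lborel)"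
    by (intro nn_integral_cmult[symmetric]) auto
  also have "\<dots> = (\<integral>\<^sup>+ x. g x \<partial>lborel)"
    using r by (intro nn_integral_cong) (simp add: g_def ennreal_mult[symmetric] diff_divide_distrib)
  finally have J: "(\<integral>\<^sup>+ x. g x \<partial>lborel) = J" by simp
  have "(\<integral>\<^sup>+ z. ennreal ((diff_quot (\<lambda>x. f ((x - a) / r)) z)\<^sup>2) \<partial>lebesgue)
      \<le> (\<integral>\<^sup>+ z. ennreal (100 * L\<^sup>2) * (g (fst z) * g (snd z)) \<partial>lebesgue)"
  proof (intro nn_integral_mono)
    fix z :: "real \<times> real"
    obtain x y where z: "z = (x, y)" by (cases z)
    let ?x = "(x - a) / r" and ?y = "(y - a) / r"
    have "diff_quot (\<lambda>x. f ((x - a) / r)) z = diff_quot f (?x, ?y) / r"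
      using r by (simp add: z diff_quot_def dist_real_def diff_divide_distrib[symmetric])
    then have "(diff_quot (\<lambda>x. f ((x - a) / r)) z)\<^sup>2 = (diff_quot f (?x, ?y))\<^sup>2 / r\<^sup>2"
      by (simp add: power_divide)
    also have "\<dots> \<le> 100 * L\<^sup>2 * (1 / (1 + ?x\<^sup>2)) * (1 / (1 + ?y\<^sup>2)) / r\<^sup>2"
      using diff_quot_lipschitz_le[OF L supp] by (intro divide_right_mono) auto
    also have "\<dots> = 100 * L\<^sup>2 * (1 / (1 + ?x\<^sup>2) / r * (1 / (1 + ?y\<^sup>2) / r))"
      by (simp add: power2_eq_square)
    finally show "ennreal ((diff_quot (\<lambda>x. f ((x - a) / r)) z)\<^sup>2)
       \<le> ennreal (100 * L\<^sup>2) * (g (fst z) * g (snd z))"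
      using r unfolding g_def z by (simp add: ennreal_mult[symmetric] ennreal_leI)
  qed
  also have "\<dots> = (\<integral>\<^sup>+ z. ennreal (100 * L\<^sup>2) * (g (fst z) * g (snd z)) \<partial>(lborel \<Otimes>\<^sub>M lborel))"
    by (simp add: nn_integral_completion lborel_prod)
  also have "\<dots> = (\<integral>\<^sup>+ x. (\<integral>\<^sup>+ y. ennreal (100 * L\<^sup>2) * (g x * g y) \<partial>lborel) \<partial>lborel)"
    by (subst lborel.nn_integral_fst[symmetric]) simp_all
  also have "\<dots> = ennreal (100 * L\<^sup>2) * J\<^sup>2"
    by (simp add: nn_integral_cmult nn_integral_multc J power2_eq_square mult.assoc)
  finally show ?thesis unfolding J_def .
qed

text \<open>The form with \<open>obtains\<close> fixes one real \<open>K\<close> before the centre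
  and the scale, so that cutoffs at all scales share it.\<close>

lemma rescaled_lipschitz_energy_bound:
  fixes f :: "real \<Rightarrow> real"
  assumes L: "\<And>x y. \<bar>f x - f y\<bar> \<le> L * \<bar>x - y\<bar>" and supp: "\<And>x. 1 < \<bar>x\<bar> \<Longrightarrow> f x = 0"
  obtains K where "\<And>a r. 0 < r \<Longrightarrow> finite_energy (\<lambda>x. f ((x - a) / r))"
    and "\<And>a r. 0 < r \<Longrightarrow> energy_form (\<lambda>x. f ((x - a) / r)) (\<lambda>x. f ((x - a) / r)) \<le> K"
proof -
  define B where "B = ennreal (100 * L\<^sup>2) * (\<integral>\<^sup>+ x. ennreal (1 / (1 + x\<^sup>2)) \<partial>(lborel :: real measure))\<^sup>2"
  have "B < \<infinity>"
    unfolding B_def using nn_integral_inverse_1_plus_square_finite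
    by (simp add: ennreal_mult_less_top power2_eq_square)
  then obtain K where K: "B = ennreal K" "0 \<le> K"
    by (cases B) auto
  have "L-lipschitz_on UNIV f"
    using L L[of 1 0] by (intro lipschitz_onI) (auto simp: dist_real_def)
  then have "continuous_on UNIV f" by (rule lipschitz_on_continuous_on)
  then have [measurable]: "f \<in> borel_measurable borel" by (rule borel_measurable_continuous_onI)
  have fe: "finite_energy (\<lambda>x. f ((x - a) / r)) \<and>
      energy_form (\<lambda>x. f ((x - a) / r)) (\<lambda>x. f ((x - a) / r)) \<le> K" if r: "0 < r" for a r
  proof -
    let ?h = "\<lambda>x. f ((x - a) / r)"
    have h: "?h \<in> borel_measurable lebesgue"
      by (intro measurable_completion) measurable
    have le: "(\<integral>\<^sup>+ z. ennreal ((diff_quot ?h z)\<^sup>2) \<partial>lebesgue) \<le> ennreal K"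
      using energy_rescaled_lipschitz_le[OF L supp r] K(1) unfolding B_def by simp
    then have i: "integrable lebesgue (\<lambda>z. (diff_quot ?h z)\<^sup>2)"
      using borel_measurable_diff_quot[OF h] by (auto simp: integrable_iff_bounded intro: le_less_trans)
    then have "ennreal (integral\<^sup>L lebesgue (\<lambda>z. (diff_quot ?h z)\<^sup>2)) \<le> ennreal K"
      using le by (subst nn_integral_eq_integral[symmetric]) auto
    then show ?thesis
      using h i K(2) by (simp add: finite_energy_def energy_form_def power2_eq_square)
  qed
  show ?thesis by (rule that[of K]) (use fe in auto)
qed

lemma finite_energy_lipschitz:
  fixes f :: "real \<Rightarrow> real"
  assumes "\<And>x y. \<bar>f x - f y\<bar> \<le> L * \<bar>x - y\<bar>" "\<And>x. 1 < \<bar>x\<bar> \<Longrightarrow> f x = 0"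
  shows "finite_energy f"
proof -
  obtain K where "\<And>a r. 0 < r \<Longrightarrow> finite_energy (\<lambda>x. f ((x - a) / r))"
    by (rule rescaled_lipschitz_energy_bound[OF assms]) blast+
  from this[of 1 0] show ?thesis by simp
qed

section \<open>Pairings with functions of shrinking support\<close>

text \<open>Dominated convergence with the energy density of \<open>f\<close> as majorant: the
  strips shrink to the cross of points having a coordinate equal to \<open>a\<close>, a null set.
  Both directions occur because the quotient of a function supported near \<open>a\<close> can be
  nonzero as soon as one variable is near \<open>a\<close>.\<close>

lemma energy_on_strips_tendsto_0:
  fixes a :: real
  assumes "finite_energy f"
  shows "(\<lambda>n. integral\<^sup>L lebesgue (\<lambda>z. indicator ({a - 1 / Suc n..a + 1 / Suc n} \<times> UNIV
            \<union> UNIV \<times> {a - 1 / Suc n..a + 1 / Suc n}) z * (diff_quot f z)\<^sup>2)) \<longlonglongrightarrow> 0"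
proof -
  define S where "S n = {a - 1 / Suc n..a + 1 / Suc n} \<times> UNIV \<union> UNIV \<times> {a - 1 / Suc n..a + 1 / Suc n}" for n
  have S: "S n \<in> sets lebesgue" for n
  proof -
    have "closed (S n)" unfolding S_def by (intro closed_Un closed_Times) auto
    then show ?thesis by (simp add: borel_closed)
  qed
  have f: "integrable lebesgue (\<lambda>z. (diff_quot f z)\<^sup>2)" "diff_quot f \<in> borel_measurable lebesgue"
    using assms borel_measurable_diff_quot by (auto simp: finite_energy_def)
  have "(\<lambda>n. integral\<^sup>L lebesgue (\<lambda>z. indicator (S n) z * (diff_quot f z)\<^sup>2))
      \<longlonglongrightarrow> integral\<^sup>L (lebesgue :: (real \<times> real) measure) (\<lambda>z. 0)"
  proof (rule integral_dominated_convergence[where w = "\<lambda>z. (diff_quot f z)\<^sup>2"])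
    show "AE z in lebesgue. (\<lambda>n. indicator (S n) z * (diff_quot f z)\<^sup>2) \<longlonglongrightarrow> 0"
      using AE_lebesgue_fst_snd_neq[of a]
    proof eventually_elim
      case (elim z)
      then have "0 < min \<bar>fst z - a\<bar> \<bar>snd z - a\<bar>" by auto
      from reals_Archimedean[OF this] obtain N where N: "1 / Suc N < min \<bar>fst z - a\<bar> \<bar>snd z - a\<bar>"
        unfolding inverse_eq_divide by blast
      have "indicator (S n) z * (diff_quot f z)\<^sup>2 = 0" if "N \<le> n" for n
      proof -
        have "1 / real (Suc n) \<le> 1 / Suc N" using that by (intro divide_left_mono) auto
        with N have "1 / real (Suc n) < \<bar>fst z - a\<bar>" "1 / real (Suc n) < \<bar>snd z - a\<bar>" by auto
        then have "z \<notin> S n" unfolding S_def by (cases z) (auto simp: abs_if split: if_splits)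
        then show ?thesis by simp
      qed
      then show ?case
        by (intro tendsto_eventually) (auto simp: eventually_sequentially)
    qed
  qed (use f S in \<open>auto simp: indicator_def\<close>)
  then show ?thesis by (simp add: S_def)
qed

text \<open>Young's inequality with a free weight in place of Cauchy-Schwarz: a small
  \<open>l\<close> tames a bounded energy of \<open>g\<close>, at the price of 1/l on the energy of
  \<open>f\<close> over \<open>S\<close> alone.\<close>

lemma energy_form_le_weighted:
  assumes f: "finite_energy f" and g: "finite_energy g" and l: "0 < l"
    and S: "S \<in> sets lebesgue" and supp: "\<And>z. z \<notin> S \<Longrightarrow> diff_quot g z = 0"
  shows "\<bar>energy_form f g\<bar> \<le> l * energy_form g g
    + 1 / l * integral\<^sup>L lebesgue (\<lambda>z. indicator S z * (diff_quot f z)\<^sup>2)"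
proof -
  have i: "integrable lebesgue (\<lambda>z. indicator S z * (diff_quot f z)\<^sup>2)"
    "integrable lebesgue (\<lambda>z. (diff_quot g z)\<^sup>2)"
    using f g integrable_mult_indicator[OF S, of "\<lambda>z. (diff_quot f z)\<^sup>2"] by (auto simp: finite_energy_def)
  have le: "\<bar>diff_quot f z * diff_quot g z\<bar> \<le> l * (diff_quot g z)\<^sup>2 + 1 / l * (indicator S z * (diff_quot f z)\<^sup>2)" for z
  proof (cases "z \<in> S")
    case True
    let ?a = "\<bar>diff_quot f z\<bar>" and ?b = "\<bar>diff_quot g z\<bar>"
    have "0 \<le> (l * ?b - ?a)\<^sup>2 / l" using l by simp
    also have "\<dots> = l * ?b\<^sup>2 + 1 / l * ?a\<^sup>2 - 2 * (?a * ?b)"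
      using l by (simp add: power2_eq_square field_simps)
    finally have "2 * (?a * ?b) \<le> l * ?b\<^sup>2 + 1 / l * ?a\<^sup>2" by linarith
    moreover have "0 \<le> ?a * ?b" by simp
    ultimately have "?a * ?b \<le> l * ?b\<^sup>2 + 1 / l * ?a\<^sup>2" by linarith
    then show ?thesis using True by (simp add: abs_mult)
  qed (use l supp in simp)
  have "\<bar>energy_form f g\<bar> \<le> integral\<^sup>L lebesgue (\<lambda>z. \<bar>diff_quot f z * diff_quot g z\<bar>)"
    unfolding energy_form_def by (rule integral_abs_bound)
  also have "\<dots> \<le> integral\<^sup>L lebesgue (\<lambda>z. l * (diff_quot g z)\<^sup>2 + 1 / l * (indicator S z * (diff_quot f z)\<^sup>2))"
    using integrable_diff_quot_mult[OF f g] i le by (intro integral_mono) auto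
  also have "\<dots> = l * energy_form g g + 1 / l * integral\<^sup>L lebesgue (\<lambda>z. indicator S z * (diff_quot f z)\<^sup>2)"
    using i by (simp add: energy_form_def power2_eq_square)
  finally show ?thesis .
qed

text \<open>The weight \<open>l\<close> is fixed first, from \<open>K\<close> and \<open>e\<close>;
  only then is \<open>n\<close> taken so large that the energy of \<open>f\<close> on the strips
  beats the factor 1/l.\<close>

lemma energy_form_shrinking_support_tendsto_0:
  assumes f: "finite_energy f" and g: "\<And>n. finite_energy (g n)"
    and supp: "\<And>n x. 1 / Suc n < \<bar>x - a\<bar> \<Longrightarrow> g n x = 0"
    and bound: "\<And>n. energy_form (g n) (g n) \<le> K"
  shows "(\<lambda>n. energy_form f (g n)) \<longlonglongrightarrow> 0"
proof (rule tendstoI)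
  fix e :: real assume e: "0 < e"
  define S where "S n = {a - 1 / Suc n..a + 1 / Suc n} \<times> UNIV \<union> UNIV \<times> {a - 1 / Suc n..a + 1 / Suc n}" for n
  define s where "s n = integral\<^sup>L lebesgue (\<lambda>z. indicator (S n) z * (diff_quot f z)\<^sup>2)" for n
  \<comment> \<open>Makes the first term at most e/2; |K| + 1 keeps the denominator positive for
    every real \<open>K\<close>. The second term is below e/2 once
    \<open>s n < l * e / 2\<close>.\<close>
  define l where "l = e / (2 * (\<bar>K\<bar> + 1))"
  have l: "0 < l" using e by (simp add: l_def)
  have lK: "l * K \<le> e / 2"
  proof -
    have "l * K \<le> l * (\<bar>K\<bar> + 1)" using l by (intro mult_left_mono) auto
    also have "\<dots> = e / 2" by (simp add: l_def field_simps)
    finally show ?thesis .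
  qed
  have "s \<longlonglongrightarrow> 0"
    using energy_on_strips_tendsto_0[OF f, of a] unfolding s_def S_def by simp
  then have "eventually (\<lambda>n. s n < l * e / 2) sequentially"
    using l e by (intro order_tendstoD) auto
  then show "eventually (\<lambda>n. dist (energy_form f (g n)) 0 < e) sequentially"
  proof eventually_elim
    case (elim n)
    have "S n \<in> sets lebesgue"
    proof -
      have "closed (S n)" unfolding S_def by (intro closed_Un closed_Times) auto
      then show ?thesis by (simp add: borel_closed)
    qed
    moreover have "diff_quot (g n) z = 0" if "z \<notin> S n" for z
    proof -
      have "1 / Suc n < \<bar>fst z - a\<bar>" "1 / Suc n < \<bar>snd z - a\<bar>"
        using that unfolding S_def by (cases z; auto)+
      then show ?thesis using supp by (simp add: diff_quot_def)
    qed
    ultimately have "\<bar>energy_form f (g n)\<bar> \<le> l * energy_form (g n) (g n) + 1 / l * s n"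
      unfolding s_def using f g l by (intro energy_form_le_weighted)
    also have "\<dots> \<le> l * K + 1 / l * s n"
      using bound l by (intro add_mono mult_left_mono) auto
    also have "\<dots> < e / 2 + e / 2"
      using lK elim l by (intro add_le_less_mono) (auto simp: field_simps)
    finally show ?case by simp
  qed
qed

section \<open>First variation away from the zero set\<close>

text \<open>Near 0 a nonzero linear term dominates and changes sign. Only small \<open>t\<close> are
  assumed, since larger perturbations may violate the sign constraint.\<close>

lemma zero_if_quadratic_nonneg_near_0:
  fixes b h :: real
  assumes d: "0 < d" and nonneg: "\<And>t. \<bar>t\<bar> \<le> d \<Longrightarrow> 0 \<le> 2 * t * b + t\<^sup>2 * h"
  shows "b = 0"
proof (rule ccontr)
  assume b: "b \<noteq> 0"
  \<comment> \<open>At \<open>t = - sgn b * s\<close> the linear term is -2 s |b|, while the second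
    bound on \<open>s\<close> gives s |h| <= |b|, so the quadratic term cannot compensate.\<close>
  define s where "s = min d (\<bar>b\<bar> / (\<bar>h\<bar> + 1))"
  have s: "0 < s" "s \<le> d" using d b by (auto simp: s_def)
  have "s * (\<bar>h\<bar> + 1) \<le> \<bar>b\<bar> / (\<bar>h\<bar> + 1) * (\<bar>h\<bar> + 1)"
    by (intro mult_right_mono) (auto simp: s_def)
  then have sh: "s * (\<bar>h\<bar> + 1) \<le> \<bar>b\<bar>" by simp
  have "0 \<le> 2 * (- sgn b * s) * b + (- sgn b * s)\<^sup>2 * h"
    using s b by (intro nonneg) (auto simp: abs_mult abs_sgn_eq)
  also have "\<dots> = s * (s * h - 2 * \<bar>b\<bar>)"
    using b by (auto simp: sgn_if power2_eq_square algebra_simps)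
  finally have "2 * \<bar>b\<bar> \<le> s * h" using s by (simp add: zero_le_mult_iff)
  also have "s * h \<le> s * (\<bar>h\<bar> + 1)" using s by (intro mult_left_mono) auto
  finally show False using sh b by simp
qed

text \<open>
  Without this the perimeter terms of \<open>(u, E)\<close> and of its competitors could not be cancelled. The
  competitor of finite energy is the pair \<open>(\<phi>, E0)\<close> of external data.
\<close>

lemma free_energy_minimizing_finite:
  fixes u :: "real \<Rightarrow> real"
  assumes ext: "external_data (1/2) \<sigma> \<phi> E0" and adm: "admissible_pair (1/2) {-1<..<1} \<phi> E0 u E"
    and min: "\<And>v F. admissible_pair (1/2) {-1<..<1} \<phi> E0 v F \<Longrightarrow>
               free_energy (1/2) \<sigma> {-1<..<1} u E \<le> free_energy (1/2) \<sigma> {-1<..<1} v F"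
    and u: "u \<in> frac_sobolev (1/2) UNIV"
  shows "free_energy (1/2) \<sigma> {-1<..<1} u E < \<infinity>"
proof -
  \<comment> \<open>External data are only locally in H^(1/2); here \<phi> is globally so, because
    both \<open>u\<close> and \<open>u - \<phi>\<close> are.\<close>
  have "(\<lambda>x. u x + (-1) * (u x - \<phi> x)) \<in> frac_sobolev (1/2) UNIV"
    using adm u by (intro frac_sobolev_half_add frac_sobolev_half_scale) (auto simp: admissible_pair_def)
  then have \<phi>: "\<phi> \<in> frac_sobolev (1/2) UNIV" by simp
  \<comment> \<open>Scaling by 0 puts the difference \<phi> - \<phi>, the zero function, into the
    space.\<close>
  have "admissible_pair (1/2) {-1<..<1} \<phi> E0 \<phi> E0"
    using ext frac_sobolev_half_scale[OF \<phi>, of 0]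
    by (auto simp: external_data_def admissible_pair_def locally_finite_frac_perimeter_def elim: eventually_mono)
  then have "free_energy (1/2) \<sigma> {-1<..<1} u E \<le> free_energy (1/2) \<sigma> {-1<..<1} \<phi> E0"
    by (rule min)
  also have "\<dots> < \<infinity>"
  proof -
    have "ball (0 :: real) 1 = {-1<..<1}" by (auto simp: dist_real_def)
    then have "frac_perimeter \<sigma> E0 {-1<..<1} < \<infinity>"
      using ext by (auto simp: external_data_def locally_finite_frac_perimeter_def dest!: spec[of _ "1::real"])
    moreover have "gagliardo_energy (1/2) (UNIV - (- {-1<..<1}) \<times> (- {-1<..<1})) \<phi>
       \<le> gagliardo_energy (1/2) (UNIV \<times> UNIV) \<phi>"
      unfolding gagliardo_energy_half by (intro nn_integral_mono ennreal_leI) (auto simp: indicator_def)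
    then have "gagliardo_energy (1/2) (UNIV - (- {-1<..<1}) \<times> (- {-1<..<1})) \<phi> < \<infinity>"
      by (rule le_less_trans) (use \<phi> in \<open>simp add: frac_sobolev_def\<close>)
    ultimately show ?thesis by (simp add: free_energy_def)
  qed
  finally show ?thesis .
qed

text \<open>The competitor is \<open>u + t * \<eta>\<close> with the same \<open>E\<close>. After
  the finite perimeters cancel, minimality makes a quadratic polynomial in \<open>t\<close>
  nonnegative near 0, and its linear coefficient is twice
  \<open>energy_form u \<eta>\<close>.\<close>

lemma first_variation_eq_0:
  fixes u :: "real \<Rightarrow> real"
  assumes ext: "external_data (1/2) \<sigma> \<phi> E0" and adm: "admissible_pair (1/2) {-1<..<1} \<phi> E0 u E"
    and min: "\<And>v F. admissible_pair (1/2) {-1<..<1} \<phi> E0 v F \<Longrightarrow>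
               free_energy (1/2) \<sigma> {-1<..<1} u E \<le> free_energy (1/2) \<sigma> {-1<..<1} v F"
    and u: "u \<in> frac_sobolev (1/2) UNIV" and cont: "continuous_on {-1..1} u"
    and C: "compact C" "C \<subseteq> {-1<..<1}" "\<And>x. x \<in> C \<Longrightarrow> u x \<noteq> 0"
    and \<eta>: "finite_energy \<eta>" "\<And>x. \<bar>\<eta> x\<bar> \<le> M" "\<And>x. x \<notin> C \<Longrightarrow> \<eta> x = 0"
  shows "energy_form u \<eta> = 0"
proof -
  define D where "D = UNIV - (- {-1<..<1::real}) \<times> (- {-1<..<1::real})"
  have D: "D \<in> sets lebesgue"
  proof -
    have "closed ((- {-1<..<1::real}) \<times> (- {-1<..<1::real}))"
      by (intro closed_Times) (auto simp: closed_def)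
    then have "open D" by (simp add: D_def open_Diff)
    then show ?thesis by (simp add: borel_open)
  qed
  \<comment> \<open>Off \<open>D\<close> both points lie outside the interval, hence outside
    \<open>C\<close>. So the change of the energy over \<open>D\<close> is expressed by the forms
    over the whole plane.\<close>
  have D_supp: "diff_quot \<eta> z = 0" if "z \<notin> D" for z
  proof -
    have "fst z \<notin> C" "snd z \<notin> C" using that C(2) by (auto simp: D_def mem_Times_iff)
    then show ?thesis using \<eta>(3) by (simp add: diff_quot_def)
  qed
  \<comment> \<open>The minimum of |u| on the compact set \<open>C\<close>; the empty set has no
    minimum, and there any positive number serves.\<close>
  obtain d where d: "0 < d" "\<And>x. x \<in> C \<Longrightarrow> d \<le> \<bar>u x\<bar>"
  proof (cases "C = {}")
    case False
    have "continuous_on C (\<lambda>x. \<bar>u x\<bar>)"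
      using C(2) by (intro continuous_intros continuous_on_subset[OF cont]) auto
    from continuous_attains_inf[OF C(1) False this] obtain x0
      where "x0 \<in> C" "\<And>x. x \<in> C \<Longrightarrow> \<bar>u x0\<bar> \<le> \<bar>u x\<bar>" by auto
    then show ?thesis using that[of "\<bar>u x0\<bar>"] C(3) by auto
  qed (use that[of 1] in auto)
  have "0 \<le> M" using order_trans[OF abs_ge_zero \<eta>(2)] .
  have fe: "finite_energy u" using u by (simp add: frac_sobolev_half_iff)
  have fin: "free_energy (1/2) \<sigma> {-1<..<1} u E < \<infinity>"
    using ext adm min u by (rule free_energy_minimizing_finite)
  have \<eta>S: "\<eta> \<in> frac_sobolev (1/2) UNIV"
  proof -
    have [measurable]: "\<eta> \<in> borel_measurable lebesgue" using \<eta>(1) by (simp add: finite_energy_def)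
    have "integrable lebesgue (\<lambda>x. (\<eta> x)\<^sup>2)"
    proof (rule Bochner_Integration.integrable_bound)
      show "integrable lebesgue (\<lambda>x. M\<^sup>2 * indicator {-1<..<1::real} x)"
        by simp
      have "(\<eta> x)\<^sup>2 \<le> M\<^sup>2" for x
        using \<eta>(2) \<open>0 \<le> M\<close> by (intro power2_le_iff_abs_le[THEN iffD2]) auto
      then show "AE x in lebesgue. norm ((\<eta> x)\<^sup>2) \<le> norm (M\<^sup>2 * indicator {-1<..<1::real} x)"
        using C(2) \<eta>(3) by (intro AE_I2) (auto simp: indicator_def subset_eq)
    qed simp
    then show ?thesis using \<eta>(1) by (simp add: frac_sobolev_half_iff)
  qed
  show ?thesis
  proof (rule zero_if_quadratic_nonneg_near_0)
    \<comment> \<open>For |t| <= d / (M + 1) the perturbation is at most \<open>d\<close>, hence at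
      most |u| on \<open>C\<close>; the added 1 covers \<open>M = 0\<close>.\<close>
    show "0 < d / (M + 1)" using d \<open>0 \<le> M\<close> by simp
    fix t assume t: "\<bar>t\<bar> \<le> d / (M + 1)"
    define v where "v x = u x + t * \<eta> x" for x
    have small: "\<bar>t * \<eta> x\<bar> \<le> d" for x
    proof -
      have "\<bar>t * \<eta> x\<bar> \<le> d / (M + 1) * (M + 1)"
        unfolding abs_mult using t \<eta>(2)[of x] \<open>0 \<le> M\<close> by (intro mult_mono) auto
      then show ?thesis using \<open>0 \<le> M\<close> by simp
    qed
    have sign: "0 \<le> u x \<Longrightarrow> 0 \<le> v x" "u x \<le> 0 \<Longrightarrow> v x \<le> 0" for x
    proof (atomize (full), cases "x \<in> C")
      case True
      then show "(0 \<le> u x \<longrightarrow> 0 \<le> v x) \<and> (u x \<le> 0 \<longrightarrow> v x \<le> 0)"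
        using d(2)[of x] small[of x] unfolding v_def by linarith
    qed (simp add: v_def \<eta>(3))
    have "admissible_pair (1/2) {-1<..<1} \<phi> E0 v E"
    proof -
      have "(\<lambda>x. (u x - \<phi> x) + t * \<eta> x) \<in> frac_sobolev (1/2) UNIV"
        using adm \<eta>S by (intro frac_sobolev_half_add frac_sobolev_half_scale) (auto simp: admissible_pair_def)
      moreover have out: "v x = u x" if "x \<notin> {-1<..<1}" for x
      proof -
        have "x \<notin> C" using that C(2) by blast
        then show ?thesis by (simp add: v_def \<eta>(3))
      qed
      moreover have "(\<lambda>x. (u x - \<phi> x) + t * \<eta> x) = (\<lambda>x. v x - \<phi> x)"
        by (auto simp: v_def)
      moreover have ae: "AE x\<in>- {-1<..<1} in lebesgue. u x = \<phi> x" "AE x\<in>E \<inter> {-1<..<1} in lebesgue. 0 \<le> u x"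
        "AE x\<in>- E \<inter> {-1<..<1} in lebesgue. u x \<le> 0"
        using adm by (simp_all only: admissible_pair_def)
      moreover have "AE x\<in>- {-1<..<1} in lebesgue. v x = \<phi> x"
        using ae(1) by eventually_elim (use out in auto)
      moreover have "AE x\<in>E \<inter> {-1<..<1} in lebesgue. 0 \<le> v x"
        using ae(2) by eventually_elim (use sign in auto)
      moreover have "AE x\<in>- E \<inter> {-1<..<1} in lebesgue. v x \<le> 0"
        using ae(3) by eventually_elim (use sign in auto)
      ultimately show ?thesis
        using adm by (simp only: admissible_pair_def)
    qed
    from min[OF this] fin
    have "gagliardo_energy (1/2) D u \<le> gagliardo_energy (1/2) D v"
      unfolding free_energy_def D_def[symmetric] by (auto simp: ennreal_add_left_cancel_le add.commute)
    moreover have gag: "gagliardo_energy (1/2) D w = ennreal (integral\<^sup>L lebesgue (\<lambda>z. indicator D z * (diff_quot w z)\<^sup>2))"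
        "integrable lebesgue (\<lambda>z. indicator D z * (diff_quot w z)\<^sup>2)"
      if "finite_energy w" for w
    proof -
      show i: "integrable lebesgue (\<lambda>z. indicator D z * (diff_quot w z)\<^sup>2)"
        using that integrable_mult_indicator[OF D, of "\<lambda>z. (diff_quot w z)\<^sup>2"]
        by (simp add: finite_energy_def)
      show "gagliardo_energy (1/2) D w = ennreal (integral\<^sup>L lebesgue (\<lambda>z. indicator D z * (diff_quot w z)\<^sup>2))"
        unfolding gagliardo_energy_half by (intro nn_integral_eq_integral i) auto
    qed
    moreover have fv: "finite_energy v"
      unfolding v_def using fe \<eta>(1) by (intro finite_energy_add finite_energy_scale)
    ultimately have "ennreal (integral\<^sup>L lebesgue (\<lambda>z. indicator D z * (diff_quot u z)\<^sup>2))
        \<le> ennreal (integral\<^sup>L lebesgue (\<lambda>z. indicator D z * (diff_quot v z)\<^sup>2))"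
      using fe by simp
    then have "integral\<^sup>L lebesgue (\<lambda>z. indicator D z * (diff_quot u z)\<^sup>2)
        \<le> integral\<^sup>L lebesgue (\<lambda>z. indicator D z * (diff_quot v z)\<^sup>2)"
      by (subst (asm) ennreal_le_iff) auto
    also have "(\<lambda>z. indicator D z * (diff_quot v z)\<^sup>2) = (\<lambda>z. indicator D z * (diff_quot u z)\<^sup>2
        + (2 * t * (diff_quot u z * diff_quot \<eta> z) + t\<^sup>2 * (diff_quot \<eta> z * diff_quot \<eta> z)))"
    proof
      fix z
      have "diff_quot v z = diff_quot u z + t * diff_quot \<eta> z"
        unfolding v_def[abs_def] diff_quot_add diff_quot_scale ..
      then show "indicator D z * (diff_quot v z)\<^sup>2 = indicator D z * (diff_quot u z)\<^sup>2
        + (2 * t * (diff_quot u z * diff_quot \<eta> z) + t\<^sup>2 * (diff_quot \<eta> z * diff_quot \<eta> z))"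
        using D_supp[of z] by (cases "z \<in> D") (auto simp: power2_eq_square algebra_simps)
    qed
    also have "integral\<^sup>L lebesgue \<dots> = integral\<^sup>L lebesgue (\<lambda>z. indicator D z * (diff_quot u z)\<^sup>2)
        + (2 * t * energy_form u \<eta> + t\<^sup>2 * energy_form \<eta> \<eta>)"
      using gag(2)[OF fe] integrable_diff_quot_mult[OF fe \<eta>(1)] integrable_diff_quot_mult[OF \<eta>(1) \<eta>(1)]
      unfolding energy_form_def
      by (simp only: Bochner_Integration.integral_add Bochner_Integration.integrable_add
          integrable_mult_right integral_mult_right_zero)
    finally show "0 \<le> 2 * t * energy_form u \<eta> + t\<^sup>2 * energy_form \<eta> \<eta>" by simp
  qed
qed

section \<open>Removability of finitely many points\<close>

text \<open>Split \<eta> into \<open>\<eta> * (1 - \<kappa> n)\<close> and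
  \<open>\<eta> * \<kappa> n\<close>. The first part vanishes near \<open>a\<close> and falls under
  \<open>away\<close>. The second has energy bounded in \<open>n\<close> by the product rule, so its
  pairing with \<open>u\<close> tends to 0; but that pairing equals
  \<open>energy_form u \<eta>\<close> for every \<open>n\<close>.\<close>

lemma energy_form_removable_point:
  fixes u :: "real \<Rightarrow> real"
  assumes u: "finite_energy u"
    and away: "\<And>\<zeta> C'. compact C' \<Longrightarrow> C' \<subseteq> C - {a} \<Longrightarrow> finite_energy \<zeta> \<Longrightarrow> bounded (range \<zeta>) \<Longrightarrow>
                (\<And>x. x \<notin> C' \<Longrightarrow> \<zeta> x = 0) \<Longrightarrow> energy_form u \<zeta> = 0"
    and C: "compact C"
    and \<eta>: "finite_energy \<eta>" "bounded (range \<eta>)" "\<And>x. x \<notin> C \<Longrightarrow> \<eta> x = 0"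
  shows "energy_form u \<eta> = 0"
proof -
  \<comment> \<open>A trapezoid with slopes 2 and -2. The plateau on [-1/2, 1/2] makes
    \<open>1 - \<kappa> n\<close> vanish on a whole neighbourhood of \<open>a\<close> and not just
    at \<open>a\<close>.\<close>
  define f :: "real \<Rightarrow> real" where "f x = max 0 (min 1 (2 - 2 * \<bar>x\<bar>))" for x
  have L: "\<bar>f x - f y\<bar> \<le> 2 * \<bar>x - y\<bar>" for x y
    unfolding f_def max_def min_def abs_if by (auto split: if_splits)
  have f0: "1 < \<bar>x\<bar> \<Longrightarrow> f x = 0" and f1: "\<bar>x\<bar> \<le> 1 / 2 \<Longrightarrow> f x = 1" and f01: "\<bar>f x\<bar> \<le> 1" for x
    unfolding f_def by auto
  obtain K where K: "\<And>b r. 0 < r \<Longrightarrow> finite_energy (\<lambda>x. f ((x - b) / r))"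
    "\<And>b r. 0 < r \<Longrightarrow> energy_form (\<lambda>x. f ((x - b) / r)) (\<lambda>x. f ((x - b) / r)) \<le> K"
    using rescaled_lipschitz_energy_bound[OF L f0] by blast
  obtain M where M: "\<And>x. \<bar>\<eta> x\<bar> \<le> M" using \<eta>(2) by (auto simp: bounded_iff)
  define \<kappa> where "\<kappa> n x = f ((x - a) / (1 / real (Suc n)))" for n x
  have \<kappa>: "finite_energy (\<kappa> n)" "energy_form (\<kappa> n) (\<kappa> n) \<le> K" for n
    unfolding \<kappa>_def by (rule K; simp)+
  have \<kappa>1: "\<bar>\<kappa> n x\<bar> \<le> 1" for n x unfolding \<kappa>_def by (rule f01)
  have fe: "finite_energy (\<lambda>x. \<eta> x * \<kappa> n x)" for n
    by (rule finite_energy_mult[OF \<eta>(1) \<kappa>(1) M \<kappa>1])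
  have split: "energy_form u \<eta> = energy_form u (\<lambda>x. \<eta> x * \<kappa> n x)" for n
  proof -
    have "energy_form u (\<lambda>x. \<eta> x - \<eta> x * \<kappa> n x) = 0"
    proof (rule away)
      \<comment> \<open>The radius is half the cutoff scale, which is the extent of the plateau;
        removing an open ball keeps the set compact.\<close>
      show "compact (C - ball a (1 / (2 * Suc n)))" using C by (intro compact_diff) auto
      show "finite_energy (\<lambda>x. \<eta> x - \<eta> x * \<kappa> n x)" by (intro finite_energy_diff \<eta> fe)
      have "\<bar>\<eta> x - \<eta> x * \<kappa> n x\<bar> \<le> M + M * 1" for x
      proof -
        have "\<bar>\<eta> x * \<kappa> n x\<bar> \<le> M * 1"
          unfolding abs_mult using M[of x] \<kappa>1[of n x] by (intro mult_mono) auto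
        then show ?thesis using M[of x] by linarith
      qed
      then show "bounded (range (\<lambda>x. \<eta> x - \<eta> x * \<kappa> n x))" by (auto simp: bounded_iff)
      show "\<eta> x - \<eta> x * \<kappa> n x = 0" if "x \<notin> C - ball a (1 / (2 * Suc n))" for x
      proof (cases "x \<in> C")
        case True
        with that have "\<bar>x - a\<bar> < 1 / (2 * Suc n)" by (auto simp: dist_real_def)
        then have "\<bar>x - a\<bar> * real (Suc n) \<le> 1 / 2" by (simp add: field_simps)
        then have "\<bar>(x - a) / (1 / real (Suc n))\<bar> \<le> 1 / 2" by (simp add: abs_mult del: of_nat_Suc)
        then have "\<kappa> n x = 1" unfolding \<kappa>_def by (rule f1)
        then show ?thesis by simp
      qed (simp add: \<eta>(3))
    qed auto
    then show ?thesis
      using energy_form_add[OF u finite_energy_diff[OF \<eta>(1) fe[of n]] fe[of n]] by simp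
  qed
  have "(\<lambda>n. energy_form u (\<lambda>x. \<eta> x * \<kappa> n x)) \<longlonglongrightarrow> 0"
  proof (rule energy_form_shrinking_support_tendsto_0[OF u fe])
    show "\<eta> x * \<kappa> n x = 0" if "1 / Suc n < \<bar>x - a\<bar>" for n x
    proof -
      have "1 < \<bar>x - a\<bar> * real (Suc n)" using that by (simp add: field_simps)
      then have "1 < \<bar>(x - a) / (1 / real (Suc n))\<bar>" by (simp add: abs_mult del: of_nat_Suc)
      then have "\<kappa> n x = 0" unfolding \<kappa>_def by (rule f0)
      then show ?thesis by simp
    qed
    show "energy_form (\<lambda>x. \<eta> x * \<kappa> n x) (\<lambda>x. \<eta> x * \<kappa> n x) \<le> 2 * (M\<^sup>2 * K) + 2 * energy_form \<eta> \<eta>" for n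
    proof -
      have "energy_form (\<lambda>x. \<eta> x * \<kappa> n x) (\<lambda>x. \<eta> x * \<kappa> n x)
        \<le> integral\<^sup>L lebesgue (\<lambda>z. 2 * (M\<^sup>2 * (diff_quot (\<kappa> n) z)\<^sup>2) + 2 * (1\<^sup>2 * (diff_quot \<eta> z)\<^sup>2))"
        unfolding energy_form_def power2_eq_square[symmetric]
        using fe \<kappa>(1) \<eta>(1) diff_quot_mult_le[OF M \<kappa>1]
        by (intro integral_mono) (auto simp: finite_energy_def)
      also have "\<dots> = 2 * (M\<^sup>2 * energy_form (\<kappa> n) (\<kappa> n)) + 2 * energy_form \<eta> \<eta>"
        using \<kappa>(1)[of n] \<eta>(1) by (simp add: finite_energy_def energy_form_def power2_eq_square)
      also have "\<dots> \<le> 2 * (M\<^sup>2 * K) + 2 * energy_form \<eta> \<eta>"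
        using \<kappa>(2)[of n] by (intro add_mono mult_left_mono) auto
      finally show ?thesis .
    qed
  qed
  then show ?thesis
    unfolding split[symmetric] by (simp add: LIMSEQ_const_iff)
qed

text \<open>The induction generalizes \<open>U\<close>: once the supports avoid \<open>a\<close>,
  the induction hypothesis for \<open>U - {a}\<close> removes the remaining points.\<close>

lemma energy_form_removable_finite:
  fixes u :: "real \<Rightarrow> real"
  assumes S: "finite S" and u: "finite_energy u"
    and away: "\<And>\<zeta> C'. compact C' \<Longrightarrow> C' \<subseteq> U - S \<Longrightarrow> finite_energy \<zeta> \<Longrightarrow> bounded (range \<zeta>) \<Longrightarrow>
                (\<And>x. x \<notin> C' \<Longrightarrow> \<zeta> x = 0) \<Longrightarrow> energy_form u \<zeta> = 0"
    and "compact C" "C \<subseteq> U" "finite_energy \<eta>" "bounded (range \<eta>)" "\<And>x. x \<notin> C \<Longrightarrow> \<eta> x = 0"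
  shows "energy_form u \<eta> = 0"
  using S away assms(4-)
proof (induction S arbitrary: U C \<eta> rule: finite_induct)
  case empty
  from empty.prems(1)[of C \<eta>] empty.prems(2-) show ?case by simp
next
  case (insert a S)
  show ?case
  proof (rule energy_form_removable_point[OF u, where a = a])
    fix \<zeta> C' assume C': "compact C'" "C' \<subseteq> C - {a}" "finite_energy \<zeta>" "bounded (range \<zeta>)"
      "\<And>x. x \<notin> C' \<Longrightarrow> \<zeta> x = 0"
    show "energy_form u \<zeta> = 0"
    proof (rule insert.IH[of "U - {a}"])
      fix \<xi> C'' assume C'': "compact C''" "C'' \<subseteq> U - {a} - S" "finite_energy \<xi>" "bounded (range \<xi>)"
        "\<And>x. x \<notin> C'' \<Longrightarrow> \<xi> x = 0"
      show "energy_form u \<xi> = 0"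
        by (rule insert.prems(1)[of C'']) (use C'' in auto)
    qed (use C' insert.prems in auto)
  qed (use insert.prems in auto)
qed

section \<open>Test functions and the conclusion\<close>

lemma test_function_finite_energy:
  fixes \<eta> :: "real \<Rightarrow> real"
  assumes "\<eta> \<in> test_functions {-1<..<1}"
  shows "finite_energy \<eta>" and "bounded (range \<eta>)"
proof -
  have "\<forall>k. C_k k \<eta>" and supp: "closure {x. \<eta> x \<noteq> 0} \<subseteq> {-1<..<1}"
    using assms unfolding test_functions_def by blast+
  then have "C_k (Suc 0) \<eta>" by blast
  then have diff: "\<eta> differentiable_on UNIV"
    and cont: "continuous_on UNIV (\<lambda>x. frechet_derivative \<eta> (at x) 1)"
    by simp_all
  have zero: "\<eta> x = 0" if "x \<notin> {-1<..<1}" for x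
    using subset_trans[OF closure_subset supp] that by blast
  have deriv: "(\<eta> has_field_derivative frechet_derivative \<eta> (at x) 1) (at x)" for x
  proof -
    have d: "(\<eta> has_derivative frechet_derivative \<eta> (at x)) (at x)"
      using diff by (simp add: differentiable_on_def frechet_derivative_works[symmetric])
    have "frechet_derivative \<eta> (at x) = (*) (frechet_derivative \<eta> (at x) 1)"
    proof
      fix r
      have "frechet_derivative \<eta> (at x) (r *\<^sub>R 1) = r *\<^sub>R frechet_derivative \<eta> (at x) 1"
        by (rule linear_scale[OF has_derivative_linear[OF d]])
      then show "frechet_derivative \<eta> (at x) r = frechet_derivative \<eta> (at x) 1 * r"
        unfolding real_scaleR_def mult_1_right by (simp only: mult.commute)
    qed
    then show ?thesis using d by (simp add: has_field_derivative_def)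
  qed
  have "bounded ((\<lambda>x. frechet_derivative \<eta> (at x) 1) ` {-1..1})"
    using continuous_on_subset[OF cont] by (intro compact_imp_bounded compact_continuous_image) auto
  then obtain L where "\<forall>d\<in>(\<lambda>x. frechet_derivative \<eta> (at x) 1) ` {-1..1}. norm d \<le> L"
    unfolding bounded_iff by blast
  then have L: "\<bar>frechet_derivative \<eta> (at x) 1\<bar> \<le> L" if "x \<in> {-1..1}" for x
    using that by simp
  have lip: "\<bar>\<eta> x - \<eta> y\<bar> \<le> L * \<bar>x - y\<bar>" for x y
  proof -
    \<comment> \<open>Clamping to [-1,1] leaves \<eta> unchanged, since \<eta> vanishes at the
      endpoints and beyond. As \<open>p\<close> is 1-Lipschitz, the derivative bound on [-1,1]
      becomes a global Lipschitz bound.\<close>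
    define p :: "real \<Rightarrow> real" where "p x = max (-1) (min 1 x)" for x
    have p: "\<eta> (p x) = \<eta> x" for x
      using zero[of x] zero[of 1] zero[of "-1"] by (auto simp: p_def max_def min_def)
    have "norm (\<eta> (p x) - \<eta> (p y)) \<le> L * norm (p x - p y)"
      by (rule field_differentiable_bound[of "{-1..1}"])
        (use deriv L in \<open>auto simp: p_def intro: has_field_derivative_at_within\<close>)
    also have "\<dots> \<le> L * \<bar>x - y\<bar>"
      using L[of 0] by (intro mult_left_mono) (auto simp: p_def)
    finally show ?thesis by (simp add: p)
  qed
  show "finite_energy \<eta>"
  proof (rule finite_energy_lipschitz[OF lip])
    show "\<eta> x = 0" if "1 < \<bar>x\<bar>" for x using that by (intro zero) auto
  qed
  have "\<bar>\<eta> x\<bar> \<le> L * 2" for x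
  proof (cases "x \<in> {-1<..<1}")
    case True
    have "\<bar>\<eta> x\<bar> \<le> L * \<bar>x - 1\<bar>" using lip[of x 1] zero[of 1] by simp
    also have "\<dots> \<le> L * 2" using L[of 0] True by (intro mult_left_mono) auto
    finally show ?thesis .
  qed (use zero L[of 0] in auto)
  then show "bounded (range \<eta>)" by (auto simp: bounded_iff)
qed

theorem mainTheorem6:
  fixes \<sigma> :: real and u :: "real \<Rightarrow> real" and E :: "real set"
  assumes "0 < \<sigma>" and "\<sigma> < 1"
    and "minimizing_pair (1/2) \<sigma> {-1<..<1} u E"
    and "continuous_on {-1..1} u"
    and "u \<in> frac_sobolev (1/2) UNIV"
  shows "frac_laplacian_zero (1/2) {-1<..<1} u \<or> infinite ({x. u x = 0} \<inter> {-1<..<1})"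
proof (rule disjCI)
  assume "\<not> infinite ({x. u x = 0} \<inter> {-1<..<1})"
  then have fin: "finite ({x. u x = 0} \<inter> {-1<..<1})" by simp
  obtain \<phi> E0 where min: "external_data (1/2) \<sigma> \<phi> E0" "admissible_pair (1/2) {-1<..<1} \<phi> E0 u E"
    "\<And>v F. admissible_pair (1/2) {-1<..<1} \<phi> E0 v F \<Longrightarrow>
       free_energy (1/2) \<sigma> {-1<..<1} u E \<le> free_energy (1/2) \<sigma> {-1<..<1} v F"
    using assms(3) unfolding minimizing_pair_def by blast
  have u: "finite_energy u" using assms(5) by (simp add: frac_sobolev_half_iff)
  show "frac_laplacian_zero (1/2) {-1<..<1} u"
    unfolding frac_laplacian_zero_def
  proof
    fix \<eta> :: "real \<Rightarrow> real" assume \<eta>: "\<eta> \<in> test_functions {-1<..<1}"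
    note fe = test_function_finite_energy[OF \<eta>]
    have "energy_form u \<eta> = 0"
    \<comment> \<open>The points removed are the zeros of \<open>u\<close> in the interval; on
      compact sets that avoid them the first variation applies.\<close>
    proof (rule energy_form_removable_finite[OF fin u])
      show "compact (closure {x. \<eta> x \<noteq> 0})" "closure {x. \<eta> x \<noteq> 0} \<subseteq> {-1<..<1}"
        using \<eta> by (auto simp: test_functions_def)
      show "\<eta> x = 0" if "x \<notin> closure {x. \<eta> x \<noteq> 0}" for x
        using that closure_subset[of "{x. \<eta> x \<noteq> 0}"] by auto
      fix \<zeta> C' assume C': "compact C'" "C' \<subseteq> {-1<..<1} - {x. u x = 0} \<inter> {-1<..<1}"
        "finite_energy \<zeta>" "bounded (range \<zeta>)" "\<And>x. x \<notin> C' \<Longrightarrow> \<zeta> x = 0"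
      obtain M where M: "\<And>x. \<bar>\<zeta> x\<bar> \<le> M" using C'(4) by (auto simp: bounded_iff)
      show "energy_form u \<zeta> = 0"
      proof (rule first_variation_eq_0[OF min assms(5,4) C'(1) _ _ C'(3) M C'(5)])
        show "C' \<subseteq> {-1<..<1}" using C'(2) by blast
        show "u x \<noteq> 0" if "x \<in> C'" for x using C'(2) that by blast
      qed
    qed (fact fe)+
    then have "has_bochner_integral lebesgue (\<lambda>z. diff_quot u z * diff_quot \<eta> z) 0"
      using integrable_diff_quot_mult[OF u fe(1)]
      unfolding has_bochner_integral_iff energy_form_def by blast
    moreover have "(\<lambda>z. (u (fst z) - u (snd z)) * (\<eta> (fst z) - \<eta> (snd z))
         / dist (fst z) (snd z) powr (real DIM(real) + 2 * (1/2)))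
        = (\<lambda>z. diff_quot u z * diff_quot \<eta> z)"
      by (simp add: diff_quot_def dist_powr_2 power2_eq_square)
    ultimately show "has_bochner_integral lebesgue
        (\<lambda>z. (u (fst z) - u (snd z)) * (\<eta> (fst z) - \<eta> (snd z))
         / dist (fst z) (snd z) powr (real DIM(real) + 2 * (1/2))) 0"
      by simp
  qed
qed

end
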